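(* Let $\Psi$ be a regular solution of the von Kármán equations and let $\Psi_{dG}\in\boldsymbol P_2(\mathcal T)$ be the (local) solution of the discrete problem $A_{dG}(\Psi_{dG},\Phi_{dG})+B_{dG}(\Psi_{dG},\Psi_{dG},\Phi_{dG})=L_{dG}(\Phi_{dG})$ for all $\Phi_{dG}\in\boldsymbol P_2(\mathcal T)$. For sufficiently large $\sigma_2$ and sufficiently small $h$, it holds $$|||\Psi-\Psi_{dG}|||_{dG}\le C h^{\alpha}$$ with a constant $C$ independent of $h$.
   Context: Continuous problem. $\Omega\subset\mathbb R^2$ is a bounded polygonal domain, $X:=H^2_0(\Omega)$, and bold letters denote products ($\boldsymbol X=X\times X$, $\boldsymbol H^s=H^s\times H^s$, etc.). $\alpha\in(1/2,1]$ is the index of elliptic regularity of $\Omega$: solutions $w\in H^2_0(\Omega)$ of $\Delta^2w=g$ with $g\in H^{-1}(\Omega)$ lie in $H^{2+\alpha}(\Omega)$ (with norm bound). The von Kármán bracket is $[\eta,\chi]=\eta_{xx}\chi_{yy}+\eta_{yy}\chi_{xx}-2\eta_{xy}\chi_{xy}$. For $f\in L^2(\Omega)$ put $a(\eta,\chi)=\int_\Omega D^2\eta:D^2\chi\,dx$, $b(\eta,\chi,\varphi)=-\frac12\int_\Omega[\eta,\chi]\varphi\,dx$, $l(\varphi)=\int_\Omega f\varphi\,dx$, and for $\Xi=(\xi_1,\xi_2),\Theta=(\theta_1,\theta_2),\Phi=(\varphi_1,\varphi_2)\in\boldsymbol X$: $A(\Theta,\Phi)=a(\theta_1,\varphi_1)+a(\theta_2,\varphi_2)$,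 $B(\Xi,\Theta,\Phi)=b(\xi_1,\theta_2,\varphi_1)+b(\xi_2,\theta_1,\varphi_1)-b(\xi_1,\theta_1,\varphi_2)$, $L(\Phi)=l(\varphi_1)$, $|||\Phi|||_2=(|\varphi_1|_{H^2(\Omega)}^2+|\varphi_2|_{H^2(\Omega)}^2)^{1/2}$. A regular solution is $\Psi=(u,v)\in\boldsymbol X$ with $A(\Psi,\Phi)+B(\Psi,\Psi,\Phi)-L(\Phi)=0$ for all $\Phi\in\boldsymbol X$ (weak form of $\Delta^2u=[u,v]+f$, $\Delta^2v=-\frac12[u,u]$) such that $$0<\beta:=\inf_{\Theta\in \boldsymbol X,\,|||\Theta|||_2=1}\ \sup_{\Phi\in \boldsymbol X,\,|||\Phi|||_2=1}\big(A(\Theta,\Phi)+2B(\Psi,\Theta,\Phi)\big).$$ Regular solutions belong to $\boldsymbol H^{2+\alpha}(\Omega)$. Discretization. $\mathcal T$ ranges over a shape-regular family of triangulations of $\Omega$ into closed triangles; $h_K=\mathrm{diam}\,K$, $h=\max_{K\in\mathcal T} h_K$; $\mathcal E$ is the set of all edges (interior and boundary), $h_E$ the length and $\nu_E$ a unit normal of $E\in\mathcal E$. $P_r(\mathcal T)$ is the space of (discontinuous) piecewise polynomials of degree $\le r$, $\boldsymbol P_2(\mathcal T)=P_2(\mathcal T)^2$. $H^s(\mathcal T)$ is the broken Sobolev space with seminorm $|\cdot|_{H^s(\mathcal T)}$. For an interior edge $E=\partial K_+\cap\partial K_-$: $[\varphi]_E=\varphi|_{K_+}-\varphi|_{K_-}$,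 $\langle\varphi\rangle_E=\frac12(\varphi|_{K_+}+\varphi|_{K_-})$; for a boundary edge $[\varphi]_E=\langle\varphi\rangle_E=\varphi|_E$ (componentwise for vector functions). For stabilization parameters $\sigma_1,\sigma_2>0$: $$a_{dG}(\eta,\chi)=\sum_{K}\int_K D^2\eta:D^2\chi\,dx-J(\eta,\chi)-J(\chi,\eta)+J_{\sigma_1,\sigma_2}(\eta,\chi),\quad J(\eta,\chi)=\sum_{E\in\mathcal E}\int_E[\nabla\chi]_E\cdot\langle D^2\eta\,\nu_E\rangle_E\,ds,$$ $$J_{\sigma_1,\sigma_2}(\eta,\chi)=\sum_{E\in\mathcal E}\frac{\sigma_1}{h_E^3}\int_E[\eta]_E[\chi]_E\,ds+\sum_{E\in\mathcal E}\frac{\sigma_2}{h_E}\int_E[\nabla\eta\cdot\nu_E]_E[\nabla\chi\cdot\nu_E]_E\,ds,$$ $b_{dG}(\eta,\chi,\varphi)=-\frac12\sum_K\int_K[\eta,\chi]\varphi\,dx$; $A_{dG}(\Theta,\Phi)=a_{dG}(\theta_1,\varphi_1)+a_{dG}(\theta_2,\varphi_2)$; $B_{dG}(\Xi,\Theta,\Phi)=b_{dG}(\xi_1,\theta_2,\varphi_1)+b_{dG}(\xi_2,\theta_1,\varphi_1)-b_{dG}(\xi_1,\theta_1,\varphi_2)$; $L_{dG}(\Phi)=\sum_K\int_K f\varphi_1\,dx$. Norms: $\|\varphi\|_{dG}^2=|\varphi|_{H^2(\mathcal T)}^2+\sum_{E\in\mathcal E}\frac{\sigma_1}{h_E^3}\|[\varphi]_E\|_{L^2(E)}^2+\sum_{E\in\mathcal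 E}\frac{\sigma_2}{h_E}\|[\nabla\varphi\cdot\nu_E]_E\|_{L^2(E)}^2$, $|||\Phi|||_{dG}^2=\|\varphi_1\|_{dG}^2+\|\varphi_2\|_{dG}^2$. Interpolation. $\Pi_h:H^s(\mathcal T)\to P_2(\mathcal T)$ (applied componentwise) is a fixed linear operator with $\|\varphi-\Pi_h\varphi\|_{H^q(K)}\le C h_K^{\min(3,s)-q}\|\varphi\|_{H^s(K)}$ for $0\le q\le s$, $K\in\mathcal T$, and $\|\varphi-\Pi_h\varphi\|_{dG}\le C h^\alpha\|\varphi\|_{H^{2+\alpha}(\Omega)}$ for $\varphi\in H^{2+\alpha}(\Omega)$. Local discrete solution. $\mathbb B_R(\Pi_h\Psi)=\{\Phi_{dG}\in\boldsymbol P_2(\mathcal T):|||\Phi_{dG}-\Pi_h\Psi|||_{dG}\le R\}$. For sufficiently large $\sigma_2$ and sufficiently small $h$ the form $\tilde{\mathcal A}_{dG}(\Theta,\Phi)=A_{dG}(\Theta,\Phi)+2B_{dG}(\Pi_h\Psi,\Theta,\Phi)$ satisfies an $h$-uniform inf-sup condition on $\boldsymbol P_2(\mathcal T)$, so that $\mu:\boldsymbol P_2(\mathcal T)\to\boldsymbol P_2(\mathcal T)$ is well defined by $\tilde{\mathcal A}_{dG}(\mu(\Theta),\Phi)=L_{dG}(\Phi)+2B_{dG}(\Pi_h\Psi,\Theta,\Phi)-B_{dG}(\Theta,\Theta,\Phi)$ for all $\Phi\in\boldsymbol P_2(\mathcal T)$. $R(h):=2C_1h^\alpha$, where $C_1>0$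 is an $h$-independent constant with $|||\mu(\Theta)-\Pi_h\Psi|||_{dG}\le C_1(h^\alpha+|||\Theta-\Pi_h\Psi|||_{dG}^2)$ for all $\Theta\in\boldsymbol P_2(\mathcal T)$. The local discrete solution $\Psi_{dG}$ is the unique solution of the discrete problem in $\mathbb B_{R(h)}(\Pi_h\Psi)$ (which exists for sufficiently large $\sigma_2$ and sufficiently small $h$). Convention. "For sufficiently large $\sigma_2$ and sufficiently small $h$ ..." means: there exists $\underline\sigma_2$ such that for all $\sigma_2\ge\underline\sigma_2$ (large enough that $a_{dG}$ is elliptic, i.e. $\beta_0\|\theta\|_{dG}^2\le a_{dG}(\theta,\theta)$ on $P_2(\mathcal T)$ with some $h$-independent $\beta_0>0$), there exists $h(\sigma_2)>0$ such that for all $\mathcal T$ with $h\le h(\sigma_2)$ the assertion holds. $\sigma_1>0$ is fixed. *)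

theory Defs
  imports "HOL-Analysis.Analysis"
begin

text \<open>
  Conventions. An element of a Sobolev space on \<open>U\<close> is represented by a function on the whole
  plane, of which only the values almost everywhere on \<open>U\<close> matter; an element of a product space
  is a pair of such functions. Norms take values in \<^typ>\<open>ennreal\<close> and are infinite outside the
  corresponding space.

  Weak derivatives and traces are unique only up to null sets, hence they are introduced as sets
  of representatives. Norms are infima over the representatives (all of which give the same
  value); the infimum over the empty set is infinite, so a missing derivative or trace yields an
  infinite norm. The bilinear and trilinear forms integrate some representative.
\<close>

type_synonym plane = "real ^ 2"
type_synonym scalar_fn = "plane \<Rightarrow> real"
type_synonym vector_fn = "scalar_fn \<times> scalar_fn"

definition esqrt :: "ennreal \<Rightarrow> ennreal" where
  "esqrt a = (if a = \<infinity> then \<infinity> else ennreal (sqrt (enn2real a)))"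

text \<open>Partial derivatives of higher order are indexed by lists of coordinate directions.\<close>

primrec pdiff :: "2 list \<Rightarrow> scalar_fn \<Rightarrow> scalar_fn" where
  "pdiff [] \<phi> = \<phi>"
| "pdiff (i # \<beta>) \<phi> = (\<lambda>x. frechet_derivative (pdiff \<beta> \<phi>) (at x) (axis i 1))"

definition smooth :: "scalar_fn \<Rightarrow> bool" where
  "smooth \<phi> \<longleftrightarrow> (\<forall>\<beta> x. pdiff \<beta> \<phi> differentiable (at x))"

definition test_functions :: "plane set \<Rightarrow> scalar_fn set" where
  "test_functions U = {\<phi>. smooth \<phi> \<and> (\<exists>S. compact S \<and> S \<subseteq> U \<and> (\<forall>x. x \<notin> S \<longrightarrow> \<phi> x = 0))}"

definition locally_integrable :: "plane set \<Rightarrow> scalar_fn \<Rightarrow> bool" where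
  "locally_integrable U w \<longleftrightarrow> (\<forall>S. compact S \<and> S \<subseteq> U \<longrightarrow> set_integrable lborel S w)"

definition weak_derivs :: "plane set \<Rightarrow> 2 list \<Rightarrow> scalar_fn \<Rightarrow> scalar_fn set" where
  "weak_derivs U \<beta> w = {g. locally_integrable U w \<and> locally_integrable U g \<and>
     (\<forall>\<phi>\<in>test_functions U.
        (LINT x:U|lborel. w x * pdiff \<beta> \<phi> x) = (-1) ^ length \<beta> * (LINT x:U|lborel. g x * \<phi> x))}"

definition weak_deriv :: "plane set \<Rightarrow> 2 list \<Rightarrow> scalar_fn \<Rightarrow> scalar_fn" where
  "weak_deriv U \<beta> w = (SOME g. g \<in> weak_derivs U \<beta> w)"

text \<open>
  The squared seminorm of order \<open>k\<close>. Every list of length \<open>k\<close> is counted, so for \<open>k = 2\<close> this is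
  the squared \<open>L\<^sup>2\<close> norm of the Frobenius norm of the Hessian.
\<close>

definition Hsemi2 :: "nat \<Rightarrow> plane set \<Rightarrow> scalar_fn \<Rightarrow> ennreal" where
  "Hsemi2 k U w = (\<Sum>\<beta>\<in>{\<beta>. length \<beta> = k}.
     INF g\<in>weak_derivs U \<beta> w. \<integral>\<^sup>+ x\<in>U. ennreal ((g x)\<^sup>2) \<partial>lborel)"

text \<open>The Sobolev--Slobodeckij (Gagliardo) contribution of fractional order \<open>\<theta>\<close>, in dimension two.\<close>

definition slobodeckij2 :: "nat \<Rightarrow> real \<Rightarrow> plane set \<Rightarrow> scalar_fn \<Rightarrow> ennreal" where
  "slobodeckij2 k \<theta> U w = (\<Sum>\<beta>\<in>{\<beta>. length \<beta> = k}. INF g\<in>weak_derivs U \<beta> w.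
     \<integral>\<^sup>+ x\<in>U. (\<integral>\<^sup>+ y\<in>U. ennreal ((g x - g y)\<^sup>2 / norm (x - y) powr (2 + 2 * \<theta>)) \<partial>lborel) \<partial>lborel)"

definition Hnorm :: "real \<Rightarrow> plane set \<Rightarrow> scalar_fn \<Rightarrow> ennreal" where
  "Hnorm s U w = (let k = nat \<lfloor>s\<rfloor>; \<theta> = s - real k in
     esqrt ((\<Sum>j\<le>k. Hsemi2 j U w) + (if \<theta> = 0 then 0 else slobodeckij2 k \<theta> U w)))"

definition Hspace :: "real \<Rightarrow> plane set \<Rightarrow> scalar_fn set" where
  "Hspace s U = {w. Hnorm s U w < \<infinity>}"

definition H0space :: "nat \<Rightarrow> plane set \<Rightarrow> scalar_fn set" where
  "H0space k U = {w \<in> Hspace (real k) U. \<exists>\<psi>. (\<forall>n. \<psi> n \<in> test_functions U) \<and>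
     (\<lambda>n. Hnorm (real k) U (w - \<psi> n)) \<longlonglongrightarrow> 0}"

text \<open>
  The boundary consists of finitely many pairwise disjoint simple closed polygons (every vertex
  lies on exactly two boundary segments); slits are excluded by \<open>interior (closure \<Omega>) = \<Omega>\<close>.
\<close>

definition polygonal_domain :: "plane set \<Rightarrow> bool" where
  "polygonal_domain \<Omega> \<longleftrightarrow>
     open \<Omega> \<and> connected \<Omega> \<and> bounded \<Omega> \<and> \<Omega> \<noteq> {} \<and> interior (closure \<Omega>) = \<Omega> \<and>
     (\<exists>\<S>. triangulation \<S> \<and> (\<forall>S\<in>\<S>. 1 simplex S) \<and> frontier \<Omega> = \<Union>\<S> \<and>
        (\<forall>S\<in>\<S>. \<forall>p. p extreme_point_of S \<longrightarrow> card {S'\<in>\<S>. p \<in> S'} = 2))"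

definition bracket :: "plane set \<Rightarrow> scalar_fn \<Rightarrow> scalar_fn \<Rightarrow> scalar_fn" where
  "bracket U \<eta> \<zeta> x =
     weak_deriv U [1,1] \<eta> x * weak_deriv U [2,2] \<zeta> x + weak_deriv U [2,2] \<eta> x * weak_deriv U [1,1] \<zeta> x
     - 2 * weak_deriv U [1,2] \<eta> x * weak_deriv U [1,2] \<zeta> x"

definition a_form :: "plane set \<Rightarrow> scalar_fn \<Rightarrow> scalar_fn \<Rightarrow> real" where
  "a_form U \<eta> \<zeta> =
     (LINT x:U|lborel. (\<Sum>i\<in>UNIV. \<Sum>j\<in>UNIV. weak_deriv U [i,j] \<eta> x * weak_deriv U [i,j] \<zeta> x))"

definition b_form :: "plane set \<Rightarrow> scalar_fn \<Rightarrow> scalar_fn \<Rightarrow> scalar_fn \<Rightarrow> real" where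
  "b_form U \<eta> \<zeta> \<phi> = - (1/2) * (LINT x:U|lborel. bracket U \<eta> \<zeta> x * \<phi> x)"

definition l_form :: "plane set \<Rightarrow> scalar_fn \<Rightarrow> scalar_fn \<Rightarrow> real" where
  "l_form U f \<phi> = (LINT x:U|lborel. f x * \<phi> x)"

text \<open>The vector forms are built from the scalar ones in the same way in the continuous and in
  the discrete setting.\<close>

definition vec_A :: "(scalar_fn \<Rightarrow> scalar_fn \<Rightarrow> real) \<Rightarrow> vector_fn \<Rightarrow> vector_fn \<Rightarrow> real" where
  "vec_A a \<Theta> \<Phi> = a (fst \<Theta>) (fst \<Phi>) + a (snd \<Theta>) (snd \<Phi>)"

definition vec_B :: "(scalar_fn \<Rightarrow> scalar_fn \<Rightarrow> scalar_fn \<Rightarrow> real)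
    \<Rightarrow> vector_fn \<Rightarrow> vector_fn \<Rightarrow> vector_fn \<Rightarrow> real" where
  "vec_B b \<Xi> \<Theta> \<Phi> = b (fst \<Xi>) (snd \<Theta>) (fst \<Phi>) + b (snd \<Xi>) (fst \<Theta>) (fst \<Phi>)
     - b (fst \<Xi>) (fst \<Theta>) (snd \<Phi>)"

abbreviation X_space :: "plane set \<Rightarrow> vector_fn set" where
  "X_space \<Omega> \<equiv> H0space 2 \<Omega> \<times> H0space 2 \<Omega>"

definition X_norm :: "plane set \<Rightarrow> vector_fn \<Rightarrow> ennreal" where
  "X_norm \<Omega> \<Phi> = esqrt (Hsemi2 2 \<Omega> (fst \<Phi>) + Hsemi2 2 \<Omega> (snd \<Phi>))"

definition inf_sup_const :: "plane set \<Rightarrow> vector_fn \<Rightarrow> ereal" where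
  "inf_sup_const \<Omega> \<Psi> =
     (INF \<Theta>\<in>{\<Theta>\<in>X_space \<Omega>. X_norm \<Omega> \<Theta> = 1}. SUP \<Phi>\<in>{\<Phi>\<in>X_space \<Omega>. X_norm \<Omega> \<Phi> = 1}.
        ereal (vec_A (a_form \<Omega>) \<Theta> \<Phi> + 2 * vec_B (b_form \<Omega>) \<Psi> \<Theta> \<Phi>))"

definition regular_solution :: "plane set \<Rightarrow> scalar_fn \<Rightarrow> vector_fn \<Rightarrow> bool" where
  "regular_solution \<Omega> f \<Psi> \<longleftrightarrow> \<Psi> \<in> X_space \<Omega> \<and>
     (\<forall>\<Phi>\<in>X_space \<Omega>. vec_A (a_form \<Omega>) \<Psi> \<Phi> + vec_B (b_form \<Omega>) \<Psi> \<Psi> \<Phi> - l_form \<Omega> f (fst \<Phi>) = 0) \<and>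
     0 < inf_sup_const \<Omega> \<Psi>"

text \<open>\<open>G\<close> is an element of \<open>H\<^sup>-\<^sup>1(\<Omega>)\<close>, the dual of \<open>H\<^sup>1\<^sub>0(\<Omega>)\<close>, of norm at most \<open>M\<close>.\<close>

definition dual_bounded :: "plane set \<Rightarrow> (scalar_fn \<Rightarrow> real) \<Rightarrow> real \<Rightarrow> bool" where
  "dual_bounded \<Omega> G M \<longleftrightarrow> 0 \<le> M \<and>
     (\<forall>\<phi>\<in>H0space 1 \<Omega>. \<forall>\<psi>\<in>H0space 1 \<Omega>. \<forall>c d.
        G (\<lambda>x. c * \<phi> x + d * \<psi> x) = c * G \<phi> + d * G \<psi>) \<and>
     (\<forall>\<phi>\<in>H0space 1 \<Omega>. ennreal \<bar>G \<phi>\<bar> \<le> ennreal M * Hnorm 1 \<Omega> \<phi>)"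

text \<open>Weak solutions of \<open>\<Delta>\<^sup>2w = G\<close> satisfy \<open>\<parallel>w\<parallel> \<le> C \<parallel>G\<parallel>\<close> in \<open>H\<^sup>2\<^sup>+\<^sup>\<alpha>(\<Omega>)\<close> and \<open>H\<^sup>-\<^sup>1(\<Omega>)\<close>; since the
  right-hand side is finite, this includes \<open>w \<in> H\<^sup>2\<^sup>+\<^sup>\<alpha>(\<Omega>)\<close>.\<close>

definition elliptic_regularity :: "plane set \<Rightarrow> real \<Rightarrow> bool" where
  "elliptic_regularity \<Omega> \<alpha> \<longleftrightarrow> (\<exists>C. \<forall>G M. \<forall>w\<in>H0space 2 \<Omega>.
     dual_bounded \<Omega> G M \<and> (\<forall>\<phi>\<in>H0space 2 \<Omega>. a_form \<Omega> w \<phi> = G \<phi>)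
     \<longrightarrow> Hnorm (2 + \<alpha>) \<Omega> w \<le> ennreal (C * M))"

text \<open>The library notion \<^const>\<open>triangulation\<close> demands that any two members intersect in a
  common (possibly empty) face, i.e. there are no hanging nodes.\<close>

definition triangulation_of :: "plane set \<Rightarrow> plane set set \<Rightarrow> bool" where
  "triangulation_of \<Omega> \<T> \<longleftrightarrow> triangulation \<T> \<and> (\<forall>K\<in>\<T>. 2 simplex K) \<and> \<Union>\<T> = closure \<Omega>"

definition mesh_size :: "plane set set \<Rightarrow> real" where
  "mesh_size \<T> = Max (diameter ` \<T>)"

definition shape_regular :: "plane set set set \<Rightarrow> bool" where
  "shape_regular \<F> \<longleftrightarrow>
     (\<exists>\<kappa>>0. \<forall>\<T>\<in>\<F>. \<forall>K\<in>\<T>. \<exists>x r. cball x r \<subseteq> K \<and> diameter K \<le> \<kappa> * r)"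

definition edges :: "plane set set \<Rightarrow> plane set set" where
  "edges \<T> = {E. \<exists>K\<in>\<T>. E edge_of K}"

definition interior_edge :: "plane set set \<Rightarrow> plane set \<Rightarrow> bool" where
  "interior_edge \<T> E \<longleftrightarrow> (\<exists>K\<in>\<T>. \<exists>K'\<in>\<T>. K \<noteq> K' \<and> E edge_of K \<and> E edge_of K')"

text \<open>For an interior edge, \<open>K_plus\<close> and \<open>K_minus\<close> are its two neighbours in some order; for a
  boundary edge, \<open>K_plus\<close> is its only neighbour. The unit normal points out of \<open>K_plus\<close> (hence
  towards \<open>K_minus\<close>, or out of \<open>\<Omega>\<close>), so that exchanging the two neighbours changes the signs of
  the normal and of all jumps simultaneously and leaves every form below unchanged.\<close>

definition K_plus :: "plane set set \<Rightarrow> plane set \<Rightarrow> plane set" where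
  "K_plus \<T> E = (SOME K. K \<in> \<T> \<and> E edge_of K)"

definition K_minus :: "plane set set \<Rightarrow> plane set \<Rightarrow> plane set" where
  "K_minus \<T> E = (SOME K. K \<in> \<T> \<and> E edge_of K \<and> K \<noteq> K_plus \<T> E)"

definition edge_normal :: "plane set set \<Rightarrow> plane set \<Rightarrow> plane" where
  "edge_normal \<T> E = (THE \<nu>. norm \<nu> = 1 \<and> (\<forall>x\<in>E. \<forall>y\<in>K_plus \<T> E. \<nu> \<bullet> (y - x) \<le> 0))"

text \<open>Arc length on a segment, as image of Lebesgue measure under the arc length parametrization.\<close>

definition length_measure :: "plane set \<Rightarrow> plane measure" where
  "length_measure E = (case (SOME pq. E = closed_segment (fst pq) (snd pq)) of (p, q) \<Rightarrow>
     distr (restrict_space lborel {0..dist p q}) borel (\<lambda>t. p + (t / dist p q) *\<^sub>R (q - p)))"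

text \<open>
  The traces on \<open>E\<close> of the \<open>H\<^sup>1(K)\<close> function represented by the members of \<open>W\<close>: the limits in
  \<open>L\<^sup>2(E)\<close> of the restrictions of smooth functions that converge to it in \<open>H\<^sup>1(K)\<close>.
\<close>

definition traces :: "plane set \<Rightarrow> plane set \<Rightarrow> scalar_fn set \<Rightarrow> scalar_fn set" where
  "traces K E W = {g \<in> borel_measurable borel. \<exists>w\<in>W. \<exists>\<psi>. (\<forall>n. smooth (\<psi> n)) \<and>
     (\<lambda>n. Hnorm 1 (interior K) (w - \<psi> n)) \<longlonglongrightarrow> 0 \<and>
     (\<lambda>n. \<integral>\<^sup>+ x. ennreal ((g x - \<psi> n x)\<^sup>2) \<partial>length_measure E) \<longlonglongrightarrow> 0}"

text \<open>A piecewise defined function is given by its representatives \<open>W K\<close> on each triangle \<open>K\<close>.\<close>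

definition jumps :: "plane set set \<Rightarrow> plane set \<Rightarrow> (plane set \<Rightarrow> scalar_fn set) \<Rightarrow> scalar_fn set" where
  "jumps \<T> E W =
     (if interior_edge \<T> E
      then {g - g' | g g'. g \<in> traces (K_plus \<T> E) E (W (K_plus \<T> E)) \<and>
                           g' \<in> traces (K_minus \<T> E) E (W (K_minus \<T> E))}
      else traces (K_plus \<T> E) E (W (K_plus \<T> E)))"

definition means :: "plane set set \<Rightarrow> plane set \<Rightarrow> (plane set \<Rightarrow> scalar_fn set) \<Rightarrow> scalar_fn set" where
  "means \<T> E W =
     (if interior_edge \<T> E
      then {\<lambda>x. (g x + g' x) / 2 | g g'. g \<in> traces (K_plus \<T> E) E (W (K_plus \<T> E)) \<and>
                           g' \<in> traces (K_minus \<T> E) E (W (K_minus \<T> E))}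
      else traces (K_plus \<T> E) E (W (K_plus \<T> E)))"

definition jump :: "plane set set \<Rightarrow> plane set \<Rightarrow> (plane set \<Rightarrow> scalar_fn set) \<Rightarrow> scalar_fn" where
  "jump \<T> E W = (SOME g. g \<in> jumps \<T> E W)"

definition mean :: "plane set set \<Rightarrow> plane set \<Rightarrow> (plane set \<Rightarrow> scalar_fn set) \<Rightarrow> scalar_fn" where
  "mean \<T> E W = (SOME g. g \<in> means \<T> E W)"

definition jump_norm2 :: "plane set set \<Rightarrow> plane set \<Rightarrow> (plane set \<Rightarrow> scalar_fn set) \<Rightarrow> ennreal" where
  "jump_norm2 \<T> E W = (INF g\<in>jumps \<T> E W. \<integral>\<^sup>+ x. ennreal ((g x)\<^sup>2) \<partial>length_measure E)"

text \<open>The representatives of \<open>\<Sum>\<^sub>j \<nu>\<^sub>j \<partial>\<^sub>j \<partial>\<^sup>\<beta> w\<close> on a triangle, i.e. \<open>\<nabla>w \<bullet> \<nu>\<close> for \<open>\<beta> = []\<close> and the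
  \<open>i\<close>-th component of \<open>D\<^sup>2w \<nu>\<close> for \<open>\<beta> = [i]\<close>.\<close>

definition normal_derivs :: "plane \<Rightarrow> 2 list \<Rightarrow> scalar_fn \<Rightarrow> plane set \<Rightarrow> scalar_fn set" where
  "normal_derivs \<nu> \<beta> w K =
     {\<lambda>x. \<Sum>j\<in>UNIV. d j x * \<nu> $ j | d. \<forall>j. d j \<in> weak_derivs (interior K) (\<beta> @ [j]) w}"

definition polynomials_upto :: "nat \<Rightarrow> scalar_fn set" where
  "polynomials_upto r =
     {p. \<exists>c :: nat \<Rightarrow> nat \<Rightarrow> real. \<forall>x. p x = (\<Sum>i\<le>r. \<Sum>j\<le>r - i. c i j * (x $ 1) ^ i * (x $ 2) ^ j)}"

text \<open>Members are normalized to vanish off the open triangles, so that a piecewise polynomial has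
  exactly one representative and uniqueness of discrete solutions is equality of functions.\<close>

definition pw_poly :: "nat \<Rightarrow> plane set set \<Rightarrow> scalar_fn set" where
  "pw_poly r \<T> = {\<phi>. (\<forall>K\<in>\<T>. \<exists>p\<in>polynomials_upto r. \<forall>x\<in>interior K. \<phi> x = p x) \<and>
     (\<forall>x. x \<notin> (\<Union>K\<in>\<T>. interior K) \<longrightarrow> \<phi> x = 0)}"

abbreviation vP2 :: "plane set set \<Rightarrow> vector_fn set" where
  "vP2 \<T> \<equiv> pw_poly 2 \<T> \<times> pw_poly 2 \<T>"

definition broken_Hspace :: "real \<Rightarrow> plane set set \<Rightarrow> scalar_fn set" where
  "broken_Hspace s \<T> = {w. \<forall>K\<in>\<T>. w \<in> Hspace s (interior K)}"

definition J_form :: "plane set set \<Rightarrow> scalar_fn \<Rightarrow> scalar_fn \<Rightarrow> real" where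
  "J_form \<T> \<eta> \<zeta> = (\<Sum>E\<in>edges \<T>. LINT x|length_measure E.
     (\<Sum>i\<in>UNIV. jump \<T> E (\<lambda>K. weak_derivs (interior K) [i] \<zeta>) x
              * mean \<T> E (normal_derivs (edge_normal \<T> E) [i] \<eta>) x))"

definition J_penalty :: "real \<Rightarrow> real \<Rightarrow> plane set set \<Rightarrow> scalar_fn \<Rightarrow> scalar_fn \<Rightarrow> real" where
  "J_penalty \<sigma>1 \<sigma>2 \<T> \<eta> \<zeta> =
     (\<Sum>E\<in>edges \<T>. \<sigma>1 / diameter E ^ 3 *
        (LINT x|length_measure E. jump \<T> E (\<lambda>K. {\<eta>}) x * jump \<T> E (\<lambda>K. {\<zeta>}) x)) +
     (\<Sum>E\<in>edges \<T>. \<sigma>2 / diameter E *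
        (LINT x|length_measure E. jump \<T> E (normal_derivs (edge_normal \<T> E) [] \<eta>) x
                                * jump \<T> E (normal_derivs (edge_normal \<T> E) [] \<zeta>) x))"

text \<open>The discrete forms are only evaluated on piecewise polynomials, where all traces exist.\<close>

definition a_dG :: "real \<Rightarrow> real \<Rightarrow> plane set set \<Rightarrow> scalar_fn \<Rightarrow> scalar_fn \<Rightarrow> real" where
  "a_dG \<sigma>1 \<sigma>2 \<T> \<eta> \<zeta> = (\<Sum>K\<in>\<T>. a_form (interior K) \<eta> \<zeta>)
     - J_form \<T> \<eta> \<zeta> - J_form \<T> \<zeta> \<eta> + J_penalty \<sigma>1 \<sigma>2 \<T> \<eta> \<zeta>"

definition b_dG :: "plane set set \<Rightarrow> scalar_fn \<Rightarrow> scalar_fn \<Rightarrow> scalar_fn \<Rightarrow> real" where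
  "b_dG \<T> \<eta> \<zeta> \<phi> = (\<Sum>K\<in>\<T>. b_form (interior K) \<eta> \<zeta> \<phi>)"

definition L_dG :: "scalar_fn \<Rightarrow> plane set set \<Rightarrow> vector_fn \<Rightarrow> real" where
  "L_dG f \<T> \<Phi> = (\<Sum>K\<in>\<T>. l_form (interior K) f (fst \<Phi>))"

definition dG_norm2 :: "real \<Rightarrow> real \<Rightarrow> plane set set \<Rightarrow> scalar_fn \<Rightarrow> ennreal" where
  "dG_norm2 \<sigma>1 \<sigma>2 \<T> \<phi> = (\<Sum>K\<in>\<T>. Hsemi2 2 (interior K) \<phi>) +
     (\<Sum>E\<in>edges \<T>. ennreal (\<sigma>1 / diameter E ^ 3) * jump_norm2 \<T> E (\<lambda>K. {\<phi>})) +
     (\<Sum>E\<in>edges \<T>. ennreal (\<sigma>2 / diameter E) *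
        jump_norm2 \<T> E (normal_derivs (edge_normal \<T> E) [] \<phi>))"

definition dG_norm :: "real \<Rightarrow> real \<Rightarrow> plane set set \<Rightarrow> scalar_fn \<Rightarrow> ennreal" where
  "dG_norm \<sigma>1 \<sigma>2 \<T> \<phi> = esqrt (dG_norm2 \<sigma>1 \<sigma>2 \<T> \<phi>)"

definition vdG_norm :: "real \<Rightarrow> real \<Rightarrow> plane set set \<Rightarrow> vector_fn \<Rightarrow> ennreal" where
  "vdG_norm \<sigma>1 \<sigma>2 \<T> \<Phi> = esqrt (dG_norm2 \<sigma>1 \<sigma>2 \<T> (fst \<Phi>) + dG_norm2 \<sigma>1 \<sigma>2 \<T> (snd \<Phi>))"

definition discrete_solution :: "real \<Rightarrow> real \<Rightarrow> scalar_fn \<Rightarrow> plane set set \<Rightarrow> vector_fn \<Rightarrow> bool" where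
  "discrete_solution \<sigma>1 \<sigma>2 f \<T> \<Psi> \<longleftrightarrow> \<Psi> \<in> vP2 \<T> \<and>
     (\<forall>\<Phi>\<in>vP2 \<T>. vec_A (a_dG \<sigma>1 \<sigma>2 \<T>) \<Psi> \<Phi> + vec_B (b_dG \<T>) \<Psi> \<Psi> \<Phi> = L_dG f \<T> \<Phi>)"

text \<open>The interpolation operators \<open>\<I> \<T>\<close>; the constants are uniform over the family \<open>\<F>\<close>.\<close>

definition interpolation_family ::
    "plane set \<Rightarrow> real \<Rightarrow> real \<Rightarrow> plane set set set \<Rightarrow> (plane set set \<Rightarrow> scalar_fn \<Rightarrow> scalar_fn) \<Rightarrow> bool" where
  "interpolation_family \<Omega> \<alpha> \<sigma>1 \<F> \<I> \<longleftrightarrow>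
     (\<forall>\<T>\<in>\<F>. \<forall>s\<ge>0. \<forall>\<phi>\<in>broken_Hspace s \<T>. \<I> \<T> \<phi> \<in> pw_poly 2 \<T>) \<and>
     (\<forall>\<T>\<in>\<F>. \<forall>s\<ge>0. \<forall>\<phi>\<in>broken_Hspace s \<T>. \<forall>\<psi>\<in>broken_Hspace s \<T>. \<forall>c d.
        \<I> \<T> (\<lambda>x. c * \<phi> x + d * \<psi> x) = (\<lambda>x. c * \<I> \<T> \<phi> x + d * \<I> \<T> \<psi> x)) \<and>
     (\<forall>s q. 0 \<le> q \<and> q \<le> s \<longrightarrow> (\<exists>C. \<forall>\<T>\<in>\<F>. \<forall>K\<in>\<T>. \<forall>\<phi>\<in>broken_Hspace s \<T>.
        Hnorm q (interior K) (\<phi> - \<I> \<T> \<phi>)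
          \<le> ennreal (C * diameter K powr (min 3 s - q)) * Hnorm s (interior K) \<phi>)) \<and>
     (\<forall>\<sigma>2>0. \<exists>C. \<forall>\<T>\<in>\<F>. \<forall>\<phi>\<in>Hspace (2 + \<alpha>) \<Omega>.
        dG_norm \<sigma>1 \<sigma>2 \<T> (\<phi> - \<I> \<T> \<phi>) \<le> ennreal (C * mesh_size \<T> powr \<alpha>) * Hnorm (2 + \<alpha>) \<Omega> \<phi>)"

text \<open>In the following, \<open>\<Psi>\<^sub>h\<close> stands for the interpolant of the exact solution.\<close>

definition mu_equation :: "real \<Rightarrow> real \<Rightarrow> scalar_fn \<Rightarrow> plane set set \<Rightarrow> vector_fn
    \<Rightarrow> vector_fn \<Rightarrow> vector_fn \<Rightarrow> bool" where
  "mu_equation \<sigma>1 \<sigma>2 f \<T> \<Psi>\<^sub>h \<Theta> M \<longleftrightarrow> M \<in> vP2 \<T> \<and>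
     (\<forall>\<Phi>\<in>vP2 \<T>. vec_A (a_dG \<sigma>1 \<sigma>2 \<T>) M \<Phi> + 2 * vec_B (b_dG \<T>) \<Psi>\<^sub>h M \<Phi>
        = L_dG f \<T> \<Phi> + 2 * vec_B (b_dG \<T>) \<Psi>\<^sub>h \<Theta> \<Phi> - vec_B (b_dG \<T>) \<Theta> \<Theta> \<Phi>)"

definition mu :: "real \<Rightarrow> real \<Rightarrow> scalar_fn \<Rightarrow> plane set set \<Rightarrow> vector_fn \<Rightarrow> vector_fn \<Rightarrow> vector_fn" where
  "mu \<sigma>1 \<sigma>2 f \<T> \<Psi>\<^sub>h \<Theta> = (THE M. mu_equation \<sigma>1 \<sigma>2 f \<T> \<Psi>\<^sub>h \<Theta> M)"

definition mu_estimate :: "real \<Rightarrow> real \<Rightarrow> real \<Rightarrow> scalar_fn \<Rightarrow> plane set set \<Rightarrow> vector_fn \<Rightarrow> real \<Rightarrow> bool" where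
  "mu_estimate \<alpha> \<sigma>1 \<sigma>2 f \<T> \<Psi>\<^sub>h C\<^sub>1 \<longleftrightarrow>
     (\<forall>\<Theta>\<in>vP2 \<T>. (\<exists>!M. mu_equation \<sigma>1 \<sigma>2 f \<T> \<Psi>\<^sub>h \<Theta> M) \<and>
        vdG_norm \<sigma>1 \<sigma>2 \<T> (mu \<sigma>1 \<sigma>2 f \<T> \<Psi>\<^sub>h \<Theta> - \<Psi>\<^sub>h)
          \<le> ennreal C\<^sub>1 * (ennreal (mesh_size \<T> powr \<alpha>) + (vdG_norm \<sigma>1 \<sigma>2 \<T> (\<Theta> - \<Psi>\<^sub>h))\<^sup>2))"

definition dG_ball :: "real \<Rightarrow> real \<Rightarrow> plane set set \<Rightarrow> vector_fn \<Rightarrow> real \<Rightarrow> vector_fn set" where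
  "dG_ball \<sigma>1 \<sigma>2 \<T> \<Psi>\<^sub>h R = {\<Phi>\<in>vP2 \<T>. vdG_norm \<sigma>1 \<sigma>2 \<T> (\<Phi> - \<Psi>\<^sub>h) \<le> ennreal R}"

definition local_discrete_solution :: "real \<Rightarrow> real \<Rightarrow> scalar_fn \<Rightarrow> plane set set \<Rightarrow> vector_fn \<Rightarrow> real
    \<Rightarrow> vector_fn \<Rightarrow> bool" where
  "local_discrete_solution \<sigma>1 \<sigma>2 f \<T> \<Psi>\<^sub>h R \<Psi>' \<longleftrightarrow>
     \<Psi>' \<in> dG_ball \<sigma>1 \<sigma>2 \<T> \<Psi>\<^sub>h R \<and> discrete_solution \<sigma>1 \<sigma>2 f \<T> \<Psi>' \<and>
     (\<forall>\<Phi>\<in>dG_ball \<sigma>1 \<sigma>2 \<T> \<Psi>\<^sub>h R. discrete_solution \<sigma>1 \<sigma>2 f \<T> \<Phi> \<longrightarrow> \<Phi> = \<Psi>')"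

end

theory Submission
  imports Defs
begin

text \<open>
  Write \<open>\<Psi>\<^sub>h = (\<I> \<T> (fst \<Psi>), \<I> \<T> (snd \<Psi>))\<close> for the interpolant. The error splits as
  \<open>\<Psi> - \<Psi>\<^sub>d\<^sub>G = (\<Psi> - \<Psi>\<^sub>h) - (\<Psi>\<^sub>d\<^sub>G - \<Psi>\<^sub>h)\<close>. The first difference is the interpolation error, of order
  \<open>h\<^sup>\<alpha>\<close> because regular solutions have finite \<open>H\<^sup>2\<^sup>+\<^sup>\<alpha>(\<Omega>)\<close> norm; the second one is bounded by the
  radius \<open>2 C\<^sub>1 h\<^sup>\<alpha>\<close> of the ball around \<open>\<Psi>\<^sub>h\<close> in which the local discrete solution lies. So the
  theorem is a triangle inequality, and all that has to be proved is that the dG norm satisfies one.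

  This is not immediate, as the norm is built from infima over representatives of weak derivatives
  and of traces, and is infinite where these do not exist. Since only the order in \<open>h\<close> matters, the
  squared norm is estimated in the lossy form \<open>\<parallel>w - v\<parallel>\<^sup>2 \<le> 2 \<parallel>w\<parallel>\<^sup>2 + 2 \<parallel>v\<parallel>\<^sup>2\<close>
  (\<open>dG_norm2_diff_le\<close>). In this form the estimate follows from the pointwise inequality
  \<open>(a - b)\<^sup>2 \<le> 2 a\<^sup>2 + 2 b\<^sup>2\<close> separately for each summand of the norm. What carries it are the facts that differences of
  representatives represent the difference, for weak derivatives (\<open>weak_derivs_diff\<close>), traces
  (\<open>traces_diff\<close>) and jumps (\<open>jumps_diff\<close>). These are statements about differences rather than sums
  because both parts of the error are measured from \<open>\<Psi>\<^sub>h\<close>.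
\<close>

section \<open>Infima, squares and square roots in the extended nonnegative reals\<close>

lemma ennreal_square_diff_le:
  "ennreal ((a - b)\<^sup>2) \<le> 2 * ennreal (a\<^sup>2) + 2 * ennreal (b\<^sup>2)"
proof -
  have "(a - b)\<^sup>2 \<le> 2 * a\<^sup>2 + 2 * b\<^sup>2"
    using zero_le_power2[of "a + b"] by (simp add: power2_eq_square algebra_simps)
  then have "ennreal ((a - b)\<^sup>2) \<le> ennreal (2 * a\<^sup>2 + 2 * b\<^sup>2)"
    by (rule ennreal_leI)
  then show ?thesis
    by (simp add: ennreal_plus ennreal_mult)
qed

lemma nn_integral_square_diff_le:
  assumes "f \<in> borel_measurable M" "g \<in> borel_measurable M"
  shows "(\<integral>\<^sup>+ x. ennreal ((f x - g x)\<^sup>2) \<partial>M)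
    \<le> 2 * (\<integral>\<^sup>+ x. ennreal ((f x)\<^sup>2) \<partial>M) + 2 * (\<integral>\<^sup>+ x. ennreal ((g x)\<^sup>2) \<partial>M)"
proof -
  have "(\<integral>\<^sup>+ x. ennreal ((f x - g x)\<^sup>2) \<partial>M)
      \<le> (\<integral>\<^sup>+ x. 2 * ennreal ((f x)\<^sup>2) + 2 * ennreal ((g x)\<^sup>2) \<partial>M)"
    by (intro nn_integral_mono ennreal_square_diff_le)
  also have "\<dots> = 2 * (\<integral>\<^sup>+ x. ennreal ((f x)\<^sup>2) \<partial>M) + 2 * (\<integral>\<^sup>+ x. ennreal ((g x)\<^sup>2) \<partial>M)"
    using assms by (simp add: nn_integral_add nn_integral_cmult)
  finally show ?thesis .
qed

text \<open>
  The passage from a bound for each pair of representatives to a bound for norms. An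
  empty index set means that a derivative or a trace does not exist; the infimum on the right-hand
  side is then infinite, as the norm should be.
\<close>

lemma le_INF_double_add:
  fixes f :: "'a \<Rightarrow> ennreal" and g :: "'b \<Rightarrow> ennreal"
  assumes "\<And>a b. a \<in> A \<Longrightarrow> b \<in> B \<Longrightarrow> x \<le> 2 * f a + 2 * g b"
  shows "x \<le> 2 * (INF a\<in>A. f a) + 2 * (INF b\<in>B. g b)"
proof -
  define F G where FG: "F = (INF a\<in>A. f a)" "G = (INF b\<in>B. g b)"
  have "x \<le> 2 * F + 2 * G"
  proof (rule ennreal_le_epsilon)
    fix e :: real
    assume "2 * F + 2 * G < top" and e: "0 < e"
    then have "F \<noteq> \<infinity>" "G \<noteq> \<infinity>"
      by (auto simp: ennreal_mult_top)
    then obtain a b where ab: "a \<in> A" "f a < F + ennreal (e / 4)" "b \<in> B" "g b < G + ennreal (e / 4)"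
      using INF_approx_ennreal[OF _ FG(1), of "e / 4"] INF_approx_ennreal[OF _ FG(2), of "e / 4"] e
      by auto
    have "4 * ennreal (e / 4) = ennreal (4 * (e / 4))"
      using e by (subst ennreal_mult) auto
    then have e4: "4 * ennreal (e / 4) = ennreal e"
      by simp
    have "x \<le> 2 * f a + 2 * g b"
      using assms ab by blast
    also have "\<dots> \<le> 2 * (F + ennreal (e / 4)) + 2 * (G + ennreal (e / 4))"
      using ab by (intro add_mono mult_left_mono) auto
    also have "\<dots> = 2 * F + 2 * G + (2 + 2) * ennreal (e / 4)"
      by (simp only: distrib_left distrib_right add_ac)
    also have "\<dots> = 2 * F + 2 * G + ennreal e"
      by (simp add: e4)
    finally show "x \<le> 2 * F + 2 * G + ennreal e" .
  qed
  then show ?thesis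
    by (simp add: FG)
qed

lemma esqrt_mono:
  assumes "a \<le> b"
  shows "esqrt a \<le> esqrt b"
  using assms by (cases a; cases b) (auto simp: esqrt_def top_unique intro!: ennreal_leI)

lemma esqrt_double_add_le: "esqrt (2 * a + 2 * b) \<le> 2 * (esqrt a + esqrt b)"
proof (cases "a = \<infinity> \<or> b = \<infinity>")
  case True
  then show ?thesis by (auto simp: esqrt_def)
next
  case False
  then obtain r s where rs: "a = ennreal r" "b = ennreal s" "0 \<le> r" "0 \<le> s"
    by (metis ennreal_cases infinity_ennreal_def)
  have "sqrt (2 * r + 2 * s) \<le> 2 * (sqrt r + sqrt s)"
    by (rule real_le_lsqrt) (use rs in \<open>auto simp: power2_sum power_mult_distrib\<close>)
  moreover have "2 * a + 2 * b = ennreal (2 * r + 2 * s)"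
    using rs by (simp add: ennreal_plus ennreal_mult)
  moreover have "2 * (ennreal (sqrt r) + ennreal (sqrt s)) = ennreal (2 * (sqrt r + sqrt s))"
    using rs by (simp add: ennreal_plus ennreal_mult)
  ultimately show ?thesis
    using rs unfolding esqrt_def by (simp add: ennreal_leI del: ennreal_plus distrib_left_numeral)
qed

lemma esqrt_le_iff:
  assumes "0 \<le> c"
  shows "esqrt a \<le> ennreal c \<longleftrightarrow> a \<le> ennreal (c\<^sup>2)"
proof (cases a)
  case (real r)
  then show ?thesis
    using assms by (auto simp: esqrt_def ennreal_le_iff real_sqrt_le_iff' real_le_lsqrt sqrt_le_D)
next
  case top
  then show ?thesis by (simp add: esqrt_def top_unique)
qed

section \<open>Weak derivatives of a difference\<close>

text \<open>
  Local integrability only says something about compact subsets of \<open>U\<close>; measurability on all of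
  \<open>U\<close> is obtained by exhausting \<open>U\<close> with countably many of them.
\<close>

lemma locally_integrable_measurable:
  assumes "open U" "locally_integrable U w"
  shows "(\<lambda>x. indicator U x * w x) \<in> borel_measurable lborel"
proof -
  obtain C where C: "\<And>n. compact (C n)" "\<And>n. C n \<subseteq> U" "\<And>n. C n \<subseteq> interior (C (Suc n))"
    "\<Union> (range C) = U" and ex: "\<And>K. \<lbrakk>compact K; K \<subseteq> U\<rbrakk> \<Longrightarrow> \<exists>N. \<forall>n\<ge>N. K \<subseteq> C n"
    by (rule open_Union_compact_subsets[OF \<open>open U\<close>], rule that)
  have "(\<lambda>x. indicator (C n) x * w x) \<in> borel_measurable lborel" for n
  proof -
    have "integrable lborel (\<lambda>x. indicator (C n) x *\<^sub>R w x)"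
      using assms(2) C(1,2) by (simp add: locally_integrable_def set_integrable_def)
    from borel_measurable_integrable[OF this] show ?thesis
      by simp
  qed
  moreover have "(\<lambda>n. indicator (C n) x * w x) \<longlonglongrightarrow> indicator U x * w x" for x
  proof (cases "x \<in> U")
    case True
    then obtain N where "\<forall>n\<ge>N. {x} \<subseteq> C n"
      using ex[of "{x}"] by auto
    then show ?thesis
      using True by (intro tendsto_eventually) (auto simp: eventually_sequentially intro!: exI[of _ N])
  next
    case False
    then have "x \<notin> C n" for n
      using C by auto
    with False show ?thesis by simp
  qed
  ultimately show ?thesis
    by (rule borel_measurable_LIMSEQ_real[rotated])
qed

lemma locally_integrable_diff:
  assumes "locally_integrable U w" "locally_integrable U v"
  shows "locally_integrable U (w - v)"
  using assms unfolding locally_integrable_def by (auto simp: fun_diff_def)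

text \<open>
  The Lebesgue integral is zero for functions that are not integrable, so it is additive only once
  integrability is known. This lemma provides it for both sides of the identity that defines weak
  derivatives.
\<close>

lemma set_integrable_mult_compact_support:
  fixes u :: scalar_fn
  assumes w: "locally_integrable U w" and S: "compact S" "S \<subseteq> U"
    and u: "continuous_on UNIV u" "\<And>x. x \<notin> S \<Longrightarrow> u x = 0"
  shows "set_integrable lborel U (\<lambda>x. w x * u x)"
proof -
  have "compact (u ` S)"
    using S(1) u(1) continuous_on_subset by (blast intro: compact_continuous_image)
  then have "bounded (u ` S)"
    by (rule compact_imp_bounded)
  then obtain B where "\<forall>y\<in>u ` S. norm y \<le> B"
    by (auto simp only: bounded_iff)
  then have B: "\<bar>u x\<bar> \<le> B" if "x \<in> S" for x
    using that by simp
  have int: "integrable lborel (\<lambda>x. indicator S x * w x)"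
    using w S unfolding locally_integrable_def set_integrable_def by auto
  have meas: "u \<in> borel_measurable lborel"
    using borel_measurable_continuous_onI[OF u(1)] by simp
  have "integrable lborel (\<lambda>x. (indicator S x * w x) * u x)"
  proof (rule Bochner_Integration.integrable_bound)
    show "integrable lborel (\<lambda>x. B * (indicator S x * w x))"
      using int by simp
    show "(\<lambda>x. indicator S x * w x * u x) \<in> borel_measurable lborel"
      using borel_measurable_integrable[OF int] meas by (rule borel_measurable_times)
    show "AE x in lborel. norm (indicator S x * w x * u x) \<le> norm (B * (indicator S x * w x))"
    proof (rule AE_I2)
      fix x
      show "norm (indicator S x * w x * u x) \<le> norm (B * (indicator S x * w x))"
      proof (cases "x \<in> S")
        case True
        then have "\<bar>u x\<bar> \<le> \<bar>B\<bar>"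
          using B[OF True] by linarith
        then show ?thesis
          using True by (simp add: abs_mult mult.commute mult_right_mono)
      qed simp
    qed
  qed
  moreover have "indicator S x * w x * u x = indicator U x *\<^sub>R (w x * u x)" for x
    using S(2) u(2) by (auto simp: indicator_def)
  ultimately show ?thesis
    by (simp add: set_integrable_def)
qed

lemma continuous_on_pdiff:
  assumes "smooth \<phi>"
  shows "continuous_on UNIV (pdiff \<beta> \<phi>)"
  using assms unfolding smooth_def
  by (intro differentiable_imp_continuous_on) (auto simp: differentiable_on_def)

lemma pdiff_eq_0_outside:
  assumes "closed S" "\<And>x. x \<notin> S \<Longrightarrow> \<phi> x = 0" "x \<notin> S"
  shows "pdiff \<beta> \<phi> x = 0"
  using assms(3)
proof (induction \<beta> arbitrary: x)
  case Nil
  then show ?case using assms by simp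
next
  case (Cons i \<beta>)
  have "((\<lambda>_. 0) has_derivative (\<lambda>_. 0)) (at x)"
    by simp
  then have "(pdiff \<beta> \<phi> has_derivative (\<lambda>_. 0)) (at x)"
    by (rule has_derivative_transform_within_open[where s = "- S"])
      (use assms Cons in auto)
  then show ?case
    by (simp add: frechet_derivative_at[symmetric])
qed

lemma pdiff_diff:
  assumes "smooth \<phi>" "smooth \<psi>"
  shows "pdiff \<beta> (\<phi> - \<psi>) = pdiff \<beta> \<phi> - pdiff \<beta> \<psi>"
proof (induction \<beta>)
  case (Cons i \<beta>)
  show ?case
  proof
    fix x
    have "((pdiff \<beta> \<phi> - pdiff \<beta> \<psi>) has_derivative
       (\<lambda>h. frechet_derivative (pdiff \<beta> \<phi>) (at x) h - frechet_derivative (pdiff \<beta> \<psi>) (at x) h)) (at x)"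
      using assms unfolding smooth_def fun_diff_def
      by (intro has_derivative_diff) (auto simp flip: frechet_derivative_works)
    from frechet_derivative_at[OF this, symmetric]
    show "pdiff (i # \<beta>) (\<phi> - \<psi>) x = (pdiff (i # \<beta>) \<phi> - pdiff (i # \<beta>) \<psi>) x"
      by (simp only: pdiff.simps Cons.IH) simp
  qed
qed simp

lemma smooth_diff:
  assumes "smooth \<phi>" "smooth \<psi>"
  shows "smooth (\<phi> - \<psi>)"
  unfolding smooth_def pdiff_diff[OF assms]
  using assms by (auto simp: smooth_def fun_diff_def)

lemma smooth_measurable:
  assumes "smooth \<phi>"
  shows "\<phi> \<in> borel_measurable borel"
  using continuous_on_pdiff[OF assms, of "[]"] by (simp add: borel_measurable_continuous_onI)

lemma weak_derivs_diff:
  assumes g: "g \<in> weak_derivs U \<beta> w" and g': "g' \<in> weak_derivs U \<beta> v"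
  shows "g - g' \<in> weak_derivs U \<beta> (w - v)"
proof -
  have "(LINT x:U|lborel. (w - v) x * pdiff \<beta> \<phi> x)
      = (-1) ^ length \<beta> * (LINT x:U|lborel. (g - g') x * \<phi> x)" if \<phi>: "\<phi> \<in> test_functions U" for \<phi>
  proof -
    obtain S where S: "compact S" "S \<subseteq> U" "\<forall>x. x \<notin> S \<longrightarrow> \<phi> x = 0" and smooth: "smooth \<phi>"
      using \<phi> by (auto simp: test_functions_def)
    have supp: "pdiff \<gamma> \<phi> x = 0" if "x \<notin> S" for \<gamma> x
      using pdiff_eq_0_outside[of S \<phi>] S that compact_imp_closed[OF S(1)] by simp
    have int: "set_integrable lborel U (\<lambda>x. q x * pdiff \<gamma> \<phi> x)" if "locally_integrable U q" for q \<gamma>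
      using that S(1,2) continuous_on_pdiff[OF smooth] supp
      by (rule set_integrable_mult_compact_support)
    have diff: "(LINT x:U|lborel. (p - q) x * pdiff \<gamma> \<phi> x)
        = (LINT x:U|lborel. p x * pdiff \<gamma> \<phi> x) - (LINT x:U|lborel. q x * pdiff \<gamma> \<phi> x)"
      if "locally_integrable U p" "locally_integrable U q" for p q \<gamma>
      using set_integral_diff(2)[OF int[OF that(1)] int[OF that(2)]]
      by (simp add: left_diff_distrib)
    show ?thesis
      using g g' \<phi> diff[of w v \<beta>] diff[of g g' "[]"]
      by (simp add: weak_derivs_def right_diff_distrib)
  qed
  then show ?thesis
    using g g' unfolding weak_derivs_def by (auto intro: locally_integrable_diff)
qed

section \<open>Seminorms, traces and jumps of a difference\<close>

lemma Hsemi2_diff_le: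
  assumes "open U"
  shows "Hsemi2 k U (w - v) \<le> 2 * Hsemi2 k U w + 2 * Hsemi2 k U v"
proof -
  have square: "(\<integral>\<^sup>+ x\<in>U. ennreal ((g x)\<^sup>2) \<partial>lborel)
      = (\<integral>\<^sup>+ x. ennreal ((indicator U x * g x)\<^sup>2) \<partial>lborel)" for g :: scalar_fn
    by (intro nn_integral_cong) (auto simp: indicator_def)
  have "(INF g\<in>weak_derivs U \<beta> (w - v). \<integral>\<^sup>+ x\<in>U. ennreal ((g x)\<^sup>2) \<partial>lborel)
      \<le> 2 * (INF g\<in>weak_derivs U \<beta> w. \<integral>\<^sup>+ x\<in>U. ennreal ((g x)\<^sup>2) \<partial>lborel)
        + 2 * (INF g\<in>weak_derivs U \<beta> v. \<integral>\<^sup>+ x\<in>U. ennreal ((g x)\<^sup>2) \<partial>lborel)" for \<beta>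
  proof (rule le_INF_double_add)
    fix g g' assume g: "g \<in> weak_derivs U \<beta> w" and g': "g' \<in> weak_derivs U \<beta> v"
    have "(INF g\<in>weak_derivs U \<beta> (w - v). \<integral>\<^sup>+ x\<in>U. ennreal ((g x)\<^sup>2) \<partial>lborel)
        \<le> (\<integral>\<^sup>+ x\<in>U. ennreal (((g - g') x)\<^sup>2) \<partial>lborel)"
      by (rule INF_lower) (rule weak_derivs_diff[OF g g'])
    also have "\<dots> = (\<integral>\<^sup>+ x. ennreal ((indicator U x * g x - indicator U x * g' x)\<^sup>2) \<partial>lborel)"
      unfolding square by (simp add: right_diff_distrib)
    also have "\<dots> \<le> 2 * (\<integral>\<^sup>+ x. ennreal ((indicator U x * g x)\<^sup>2) \<partial>lborel)
        + 2 * (\<integral>\<^sup>+ x. ennreal ((indicator U x * g' x)\<^sup>2) \<partial>lborel)"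
      by (intro nn_integral_square_diff_le locally_integrable_measurable assms)
        (use g g' in \<open>auto simp: weak_derivs_def\<close>)
    finally show "(INF g\<in>weak_derivs U \<beta> (w - v). \<integral>\<^sup>+ x\<in>U. ennreal ((g x)\<^sup>2) \<partial>lborel)
        \<le> 2 * (\<integral>\<^sup>+ x\<in>U. ennreal ((g x)\<^sup>2) \<partial>lborel)
          + 2 * (\<integral>\<^sup>+ x\<in>U. ennreal ((g' x)\<^sup>2) \<partial>lborel)"
      unfolding square .
  qed
  then show ?thesis
    unfolding Hsemi2_def sum_distrib_left sum.distrib[symmetric] by (intro sum_mono)
qed

lemma Hnorm_1_diff_le:
  assumes "open U"
  shows "Hnorm 1 U (w - v) \<le> 2 * (Hnorm 1 U w + Hnorm 1 U v)"
proof -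
  have eq: "Hnorm 1 U u = esqrt (\<Sum>j\<le>1. Hsemi2 j U u)" for u
    by (simp add: Hnorm_def)
  have "(\<Sum>j\<le>1. Hsemi2 j U (w - v)) \<le> 2 * (\<Sum>j\<le>1. Hsemi2 j U w) + 2 * (\<Sum>j\<le>1. Hsemi2 j U v)"
    unfolding sum_distrib_left sum.distrib[symmetric] by (intro sum_mono Hsemi2_diff_le assms)
  then show ?thesis
    unfolding eq using esqrt_mono esqrt_double_add_le order_trans by blast
qed

lemma measurable_length_measure:
  "borel_measurable (length_measure E) = borel_measurable (borel :: plane measure)"
  by (rule measurable_cong_sets) (auto simp: length_measure_def split: prod.split)

text \<open>
  A trace comes with a sequence of smooth functions converging to the function in \<open>H\<^sup>1(K)\<close> and to
  the trace in \<open>L\<^sup>2(E)\<close>. The differences of two such sequences converge to the difference in both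
  norms; the quasi-triangle inequalities suffice here because both limits are zero.
\<close>

lemma traces_diff:
  assumes g: "g \<in> traces K E W" and g': "g' \<in> traces K E V"
    and WV: "\<And>w v. w \<in> W \<Longrightarrow> v \<in> V \<Longrightarrow> w - v \<in> Z"
  shows "g - g' \<in> traces K E Z"
proof -
  obtain w \<psi> where w: "w \<in> W" "\<And>n. smooth (\<psi> n)" "g \<in> borel_measurable borel"
    "(\<lambda>n. Hnorm 1 (interior K) (w - \<psi> n)) \<longlonglongrightarrow> 0"
    "(\<lambda>n. \<integral>\<^sup>+ x. ennreal ((g x - \<psi> n x)\<^sup>2) \<partial>length_measure E) \<longlonglongrightarrow> 0"
    using g by (auto simp: traces_def)
  obtain v \<eta> where v: "v \<in> V" "\<And>n. smooth (\<eta> n)" "g' \<in> borel_measurable borel"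
    "(\<lambda>n. Hnorm 1 (interior K) (v - \<eta> n)) \<longlonglongrightarrow> 0"
    "(\<lambda>n. \<integral>\<^sup>+ x. ennreal ((g' x - \<eta> n x)\<^sup>2) \<partial>length_measure E) \<longlonglongrightarrow> 0"
    using g' by (auto simp: traces_def)
  have vanishes: "h \<longlonglongrightarrow> 0" if "a \<longlonglongrightarrow> 0" "b \<longlonglongrightarrow> 0" "\<And>n. h n \<le> 2 * (a n + b n)"
    for h a b :: "nat \<Rightarrow> ennreal"
  proof (rule tendsto_sandwich[where f = "\<lambda>_. 0"])
    show "(\<lambda>n. 2 * (a n + b n)) \<longlonglongrightarrow> 0"
      using ennreal_tendsto_cmult[OF _ tendsto_add[OF that(1,2)], of 2] by simp
  qed (use that(3) in auto)
  have "(\<lambda>n. Hnorm 1 (interior K) ((w - v) - (\<psi> n - \<eta> n))) \<longlonglongrightarrow> 0"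
  proof (rule vanishes[OF w(4) v(4)])
    fix n
    have "(w - v) - (\<psi> n - \<eta> n) = (w - \<psi> n) - (v - \<eta> n)"
      by (simp add: fun_eq_iff)
    then show "Hnorm 1 (interior K) ((w - v) - (\<psi> n - \<eta> n))
        \<le> 2 * (Hnorm 1 (interior K) (w - \<psi> n) + Hnorm 1 (interior K) (v - \<eta> n))"
      using Hnorm_1_diff_le[of "interior K" "w - \<psi> n" "v - \<eta> n"] by simp
  qed
  moreover have "(\<lambda>n. \<integral>\<^sup>+ x. ennreal (((g - g') x - (\<psi> n - \<eta> n) x)\<^sup>2) \<partial>length_measure E) \<longlonglongrightarrow> 0"
  proof (rule vanishes[OF w(5) v(5)])
    fix n
    have "(\<integral>\<^sup>+ x. ennreal (((g x - \<psi> n x) - (g' x - \<eta> n x))\<^sup>2) \<partial>length_measure E)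
        \<le> 2 * (\<integral>\<^sup>+ x. ennreal ((g x - \<psi> n x)\<^sup>2) \<partial>length_measure E)
          + 2 * (\<integral>\<^sup>+ x. ennreal ((g' x - \<eta> n x)\<^sup>2) \<partial>length_measure E)"
      using w(3) v(3) smooth_measurable[OF w(2)] smooth_measurable[OF v(2)]
      by (intro nn_integral_square_diff_le) (simp_all add: measurable_length_measure)
    then show "(\<integral>\<^sup>+ x. ennreal (((g - g') x - (\<psi> n - \<eta> n) x)\<^sup>2) \<partial>length_measure E)
        \<le> 2 * ((\<integral>\<^sup>+ x. ennreal ((g x - \<psi> n x)\<^sup>2) \<partial>length_measure E)
          + (\<integral>\<^sup>+ x. ennreal ((g' x - \<eta> n x)\<^sup>2) \<partial>length_measure E))"
      by (simp add: algebra_simps)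
  qed
  moreover have "g - g' \<in> borel_measurable borel"
    using w(3) v(3) by (simp add: fun_diff_def)
  ultimately show ?thesis
    unfolding traces_def using WV[OF w(1) v(1)] smooth_diff[OF w(2) v(2)]
    by (intro CollectI conjI bexI[of _ "w - v"] exI[of _ "\<lambda>n. \<psi> n - \<eta> n"] allI)
qed

lemma jumps_diff:
  assumes g: "g \<in> jumps \<T> E W" and g': "g' \<in> jumps \<T> E V"
    and WV: "\<And>K w v. w \<in> W K \<Longrightarrow> v \<in> V K \<Longrightarrow> w - v \<in> Z K"
  shows "g - g' \<in> jumps \<T> E Z"
proof (cases "interior_edge \<T> E")
  case True
  then obtain p q p' q' where eq: "g = p - q" "g' = p' - q'"
    and tr: "p \<in> traces (K_plus \<T> E) E (W (K_plus \<T> E))" "q \<in> traces (K_minus \<T> E) E (W (K_minus \<T> E))"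
      "p' \<in> traces (K_plus \<T> E) E (V (K_plus \<T> E))" "q' \<in> traces (K_minus \<T> E) E (V (K_minus \<T> E))"
    using g g' by (auto simp: jumps_def)
  have "p - p' \<in> traces (K_plus \<T> E) E (Z (K_plus \<T> E))"
    "q - q' \<in> traces (K_minus \<T> E) E (Z (K_minus \<T> E))"
    using traces_diff tr WV by blast+
  moreover have "g - g' = (p - p') - (q - q')"
    by (simp add: eq fun_eq_iff)
  ultimately show ?thesis
    using True unfolding jumps_def by auto
next
  case False
  then show ?thesis
    using g g' traces_diff WV unfolding jumps_def by auto
qed

lemma jumps_measurable: "g \<in> jumps \<T> E W \<Longrightarrow> g \<in> borel_measurable (length_measure E)"
  by (auto simp: jumps_def traces_def measurable_length_measure fun_diff_def split: if_splits)

lemma jump_norm2_diff_le: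
  assumes WV: "\<And>K w v. w \<in> W K \<Longrightarrow> v \<in> V K \<Longrightarrow> w - v \<in> Z K"
  shows "jump_norm2 \<T> E Z \<le> 2 * jump_norm2 \<T> E W + 2 * jump_norm2 \<T> E V"
  unfolding jump_norm2_def
proof (rule le_INF_double_add)
  fix g g' assume g: "g \<in> jumps \<T> E W" and g': "g' \<in> jumps \<T> E V"
  have "(INF g\<in>jumps \<T> E Z. \<integral>\<^sup>+ x. ennreal ((g x)\<^sup>2) \<partial>length_measure E)
      \<le> (\<integral>\<^sup>+ x. ennreal (((g - g') x)\<^sup>2) \<partial>length_measure E)"
    by (rule INF_lower) (rule jumps_diff[OF g g' WV])
  also have "\<dots> \<le> 2 * (\<integral>\<^sup>+ x. ennreal ((g x)\<^sup>2) \<partial>length_measure E)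
      + 2 * (\<integral>\<^sup>+ x. ennreal ((g' x)\<^sup>2) \<partial>length_measure E)"
    using nn_integral_square_diff_le[OF jumps_measurable[OF g] jumps_measurable[OF g']] by simp
  finally show "(INF g\<in>jumps \<T> E Z. \<integral>\<^sup>+ x. ennreal ((g x)\<^sup>2) \<partial>length_measure E)
      \<le> 2 * (\<integral>\<^sup>+ x. ennreal ((g x)\<^sup>2) \<partial>length_measure E)
        + 2 * (\<integral>\<^sup>+ x. ennreal ((g' x)\<^sup>2) \<partial>length_measure E)" .
qed

lemma normal_derivs_diff:
  assumes "d \<in> normal_derivs \<nu> \<beta> w K" "e \<in> normal_derivs \<nu> \<beta> v K"
  shows "d - e \<in> normal_derivs \<nu> \<beta> (w - v) K"
proof -
  obtain p q where p: "d = (\<lambda>x. \<Sum>j\<in>UNIV. p j x * \<nu> $ j)" "\<And>j. p j \<in> weak_derivs (interior K) (\<beta> @ [j]) w"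
    and q: "e = (\<lambda>x. \<Sum>j\<in>UNIV. q j x * \<nu> $ j)" "\<And>j. q j \<in> weak_derivs (interior K) (\<beta> @ [j]) v"
    using assms by (auto simp: normal_derivs_def)
  have "d - e = (\<lambda>x. \<Sum>j\<in>UNIV. (p j - q j) x * \<nu> $ j)"
    by (auto simp: p q left_diff_distrib sum_subtractf)
  moreover have "p j - q j \<in> weak_derivs (interior K) (\<beta> @ [j]) (w - v)" for j
    using p q by (intro weak_derivs_diff)
  ultimately show ?thesis
    unfolding normal_derivs_def by (intro CollectI exI[of _ "\<lambda>j. p j - q j"]) auto
qed

section \<open>The dG norm of a difference and the error estimate\<close>

lemma dG_norm2_diff_le:
  "dG_norm2 \<sigma>1 \<sigma>2 \<T> (w - v) \<le> 2 * dG_norm2 \<sigma>1 \<sigma>2 \<T> w + 2 * dG_norm2 \<sigma>1 \<sigma>2 \<T> v"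
proof -
  have weighted: "(\<Sum>i\<in>I. c i * z i) \<le> 2 * (\<Sum>i\<in>I. c i * x i) + 2 * (\<Sum>i\<in>I. c i * y i)"
    if "\<And>i. z i \<le> 2 * x i + 2 * y i" for I :: "plane set set" and c x y z :: "plane set \<Rightarrow> ennreal"
  proof -
    have "c i * z i \<le> 2 * (c i * x i) + 2 * (c i * y i)" for i
      using mult_left_mono[OF that[of i], of "c i"] by (simp add: distrib_left mult_ac)
    then show ?thesis
      unfolding sum_distrib_left sum.distrib[symmetric] by (intro sum_mono)
  qed
  have cells: "(\<Sum>K\<in>\<T>. Hsemi2 2 (interior K) (w - v))
      \<le> 2 * (\<Sum>K\<in>\<T>. Hsemi2 2 (interior K) w) + 2 * (\<Sum>K\<in>\<T>. Hsemi2 2 (interior K) v)"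
    using weighted[where c = "\<lambda>_. 1"] Hsemi2_diff_le by simp
  have 1: "(\<Sum>E\<in>edges \<T>. ennreal (\<sigma>1 / diameter E ^ 3) * jump_norm2 \<T> E (\<lambda>K. {w - v}))
    \<le> 2 * (\<Sum>E\<in>edges \<T>. ennreal (\<sigma>1 / diameter E ^ 3) * jump_norm2 \<T> E (\<lambda>K. {w}))
     + 2 * (\<Sum>E\<in>edges \<T>. ennreal (\<sigma>1 / diameter E ^ 3) * jump_norm2 \<T> E (\<lambda>K. {v}))"
    by (rule weighted, rule jump_norm2_diff_le) auto
  have 2: "(\<Sum>E\<in>edges \<T>. ennreal (\<sigma>2 / diameter E) * jump_norm2 \<T> E (normal_derivs (edge_normal \<T> E) [] (w - v)))
    \<le> 2 * (\<Sum>E\<in>edges \<T>. ennreal (\<sigma>2 / diameter E) * jump_norm2 \<T> E (normal_derivs (edge_normal \<T> E) [] w))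
     + 2 * (\<Sum>E\<in>edges \<T>. ennreal (\<sigma>2 / diameter E) * jump_norm2 \<T> E (normal_derivs (edge_normal \<T> E) [] v))"
    by (rule weighted, rule jump_norm2_diff_le) (rule normal_derivs_diff)
  show ?thesis
    using add_mono[OF add_mono[OF cells 1] 2]
    unfolding dG_norm2_def by (simp add: distrib_left add_ac)
qed

text \<open>
  The triangle inequality through an intermediate \<open>\<Phi>\<close>, to be applied to the interpolant. The two
  distances to \<open>\<Phi>\<close> enter differently because the interpolation error is controlled for each
  component, whereas the distance of the discrete solution is controlled for the pair.
\<close>

lemma vdG_norm_diff_le:
  assumes "0 \<le> r" "0 \<le> s" "0 \<le> \<rho>"
    and fst: "dG_norm \<sigma>1 \<sigma>2 \<T> (fst \<Psi> - fst \<Phi>) \<le> ennreal r"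
    and snd: "dG_norm \<sigma>1 \<sigma>2 \<T> (snd \<Psi> - snd \<Phi>) \<le> ennreal s"
    and ball: "vdG_norm \<sigma>1 \<sigma>2 \<T> (\<Theta> - \<Phi>) \<le> ennreal \<rho>"
  shows "vdG_norm \<sigma>1 \<sigma>2 \<T> (\<Psi> - \<Theta>) \<le> ennreal (sqrt (2 * (r\<^sup>2 + s\<^sup>2 + \<rho>\<^sup>2)))"
proof -
  let ?n = "dG_norm2 \<sigma>1 \<sigma>2 \<T>"
  have split: "p - q = (p - c) - (q - c)" for p q c :: scalar_fn
    by (simp add: fun_eq_iff)
  have "?n (fst \<Psi> - fst \<Theta>) + ?n (snd \<Psi> - snd \<Theta>)
      \<le> (2 * ?n (fst \<Psi> - fst \<Phi>) + 2 * ?n (fst \<Theta> - fst \<Phi>))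
        + (2 * ?n (snd \<Psi> - snd \<Phi>) + 2 * ?n (snd \<Theta> - snd \<Phi>))"
    by (subst split[of "fst \<Psi>" "fst \<Theta>" "fst \<Phi>"], subst split[of "snd \<Psi>" "snd \<Theta>" "snd \<Phi>"])
      (intro add_mono dG_norm2_diff_le)
  also have "\<dots> = 2 * (?n (fst \<Psi> - fst \<Phi>) + ?n (snd \<Psi> - snd \<Phi>)
        + (?n (fst \<Theta> - fst \<Phi>) + ?n (snd \<Theta> - snd \<Phi>)))"
    by (simp add: distrib_left add_ac)
  also have "\<dots> \<le> 2 * (ennreal (r\<^sup>2) + ennreal (s\<^sup>2) + ennreal (\<rho>\<^sup>2))"
    using fst snd ball assms(1-3)
    by (intro mult_left_mono add_mono) (auto simp: dG_norm_def vdG_norm_def esqrt_le_iff)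
  also have "\<dots> = ennreal (2 * (r\<^sup>2 + s\<^sup>2 + \<rho>\<^sup>2))"
    by (simp add: ennreal_mult ennreal_plus)
  finally show ?thesis
    unfolding vdG_norm_def by (subst esqrt_le_iff) auto
qed

theorem theorem4p5:
  fixes \<Omega> :: "plane set" and \<alpha> \<sigma>1 :: real and f :: scalar_fn and \<Psi> :: vector_fn
    and \<F> :: "plane set set set" and \<I> :: "plane set set \<Rightarrow> scalar_fn \<Rightarrow> scalar_fn"
    and C\<^sub>1 :: "real \<Rightarrow> real"
  assumes domain: "polygonal_domain \<Omega>"
    and alpha: "1/2 < \<alpha>" "\<alpha> \<le> 1" "elliptic_regularity \<Omega> \<alpha>"
    and load: "f \<in> Hspace 0 \<Omega>"
    and regularity: "\<And>\<Psi>'. regular_solution \<Omega> f \<Psi>' \<Longrightarrow> \<Psi>' \<in> Hspace (2 + \<alpha>) \<Omega> \<times> Hspace (2 + \<alpha>) \<Omega>"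
    and meshes: "\<And>\<T>. \<T> \<in> \<F> \<Longrightarrow> triangulation_of \<Omega> \<T>" "shape_regular \<F>"
    and sigma1: "\<sigma>1 > 0"
    and interpolation: "interpolation_family \<Omega> \<alpha> \<sigma>1 \<F> \<I>"
    and C1: "\<exists>\<sigma>\<^sub>0>0. \<forall>\<sigma>2\<ge>\<sigma>\<^sub>0. 0 < C\<^sub>1 \<sigma>2 \<and> (\<exists>h\<^sub>0>0. \<forall>\<T>\<in>\<F>. mesh_size \<T> \<le> h\<^sub>0 \<longrightarrow>
               mu_estimate \<alpha> \<sigma>1 \<sigma>2 f \<T> (map_prod (\<I> \<T>) (\<I> \<T>) \<Psi>) (C\<^sub>1 \<sigma>2))"
    and solution: "regular_solution \<Omega> f \<Psi>"
  shows "\<exists>\<sigma>\<^sub>0>0. \<forall>\<sigma>2\<ge>\<sigma>\<^sub>0. \<exists>h\<^sub>0>0. \<exists>C>0. \<forall>\<T>\<in>\<F>. mesh_size \<T> \<le> h\<^sub>0 \<longrightarrow>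
           (\<forall>\<Psi>\<^sub>d\<^sub>G. local_discrete_solution \<sigma>1 \<sigma>2 f \<T> (map_prod (\<I> \<T>) (\<I> \<T>) \<Psi>)
                      (2 * C\<^sub>1 \<sigma>2 * mesh_size \<T> powr \<alpha>) \<Psi>\<^sub>d\<^sub>G \<longrightarrow>
              vdG_norm \<sigma>1 \<sigma>2 \<T> (\<Psi> - \<Psi>\<^sub>d\<^sub>G) \<le> ennreal (C * mesh_size \<T> powr \<alpha>))"
proof -
  obtain \<sigma>\<^sub>0 where \<sigma>\<^sub>0: "0 < \<sigma>\<^sub>0" "\<And>\<sigma>2. \<sigma>\<^sub>0 \<le> \<sigma>2 \<Longrightarrow> 0 < C\<^sub>1 \<sigma>2"
    using C1 by blast
  have \<Psi>: "fst \<Psi> \<in> Hspace (2 + \<alpha>) \<Omega>" "snd \<Psi> \<in> Hspace (2 + \<alpha>) \<Omega>"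
    using regularity[OF solution] by (simp_all add: mem_Times_iff)
  have finite_norm: "\<exists>m\<ge>0. Hnorm (2 + \<alpha>) \<Omega> \<phi> = ennreal m" if "\<phi> \<in> Hspace (2 + \<alpha>) \<Omega>" for \<phi>
    using that by (cases "Hnorm (2 + \<alpha>) \<Omega> \<phi>") (auto simp: Hspace_def)
  obtain M where M: "0 \<le> M" "Hnorm (2 + \<alpha>) \<Omega> (fst \<Psi>) = ennreal M"
    using finite_norm[OF \<Psi>(1)] by blast
  obtain N where N: "0 \<le> N" "Hnorm (2 + \<alpha>) \<Omega> (snd \<Psi>) = ennreal N"
    using finite_norm[OF \<Psi>(2)] by blast
  have estimate: "\<exists>h\<^sub>0>0. \<exists>C>0. \<forall>\<T>\<in>\<F>. mesh_size \<T> \<le> h\<^sub>0 \<longrightarrow>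
           (\<forall>\<Psi>\<^sub>d\<^sub>G. local_discrete_solution \<sigma>1 \<sigma>2 f \<T> (map_prod (\<I> \<T>) (\<I> \<T>) \<Psi>)
                      (2 * C\<^sub>1 \<sigma>2 * mesh_size \<T> powr \<alpha>) \<Psi>\<^sub>d\<^sub>G \<longrightarrow>
              vdG_norm \<sigma>1 \<sigma>2 \<T> (\<Psi> - \<Psi>\<^sub>d\<^sub>G) \<le> ennreal (C * mesh_size \<T> powr \<alpha>))"
    if "\<sigma>\<^sub>0 \<le> \<sigma>2" for \<sigma>2
  proof -
    have "0 < \<sigma>2" "0 < C\<^sub>1 \<sigma>2"
      using \<sigma>\<^sub>0 that by auto
    have "\<forall>\<sigma>2>0. \<exists>C. \<forall>\<T>\<in>\<F>. \<forall>\<phi>\<in>Hspace (2 + \<alpha>) \<Omega>.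
        dG_norm \<sigma>1 \<sigma>2 \<T> (\<phi> - \<I> \<T> \<phi>) \<le> ennreal (C * mesh_size \<T> powr \<alpha>) * Hnorm (2 + \<alpha>) \<Omega> \<phi>"
      using interpolation unfolding interpolation_family_def by (elim conjE)
    then obtain c where c: "\<forall>\<T>\<in>\<F>. \<forall>\<phi>\<in>Hspace (2 + \<alpha>) \<Omega>.
        dG_norm \<sigma>1 \<sigma>2 \<T> (\<phi> - \<I> \<T> \<phi>) \<le> ennreal (c * mesh_size \<T> powr \<alpha>) * Hnorm (2 + \<alpha>) \<Omega> \<phi>"
      using \<open>0 < \<sigma>2\<close> by blast
    \<comment> \<open>The constant \<open>c\<close> may be negative, but its positive part works equally well and makes the
      bounds real numbers that can be squared.\<close>
    define c' where "c' = max c 0"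
    have interp: "dG_norm \<sigma>1 \<sigma>2 \<T> (\<phi> - \<I> \<T> \<phi>) \<le> ennreal (c' * m * mesh_size \<T> powr \<alpha>)"
      if "\<T> \<in> \<F>" "\<phi> \<in> Hspace (2 + \<alpha>) \<Omega>" "0 \<le> m" "Hnorm (2 + \<alpha>) \<Omega> \<phi> = ennreal m" for \<T> \<phi> m
    proof -
      have "dG_norm \<sigma>1 \<sigma>2 \<T> (\<phi> - \<I> \<T> \<phi>) \<le> ennreal (c * mesh_size \<T> powr \<alpha>) * ennreal m"
        using c that by (metis (no_types))
      also have "\<dots> \<le> ennreal (c' * mesh_size \<T> powr \<alpha>) * ennreal m"
        by (intro mult_right_mono ennreal_leI) (auto simp: c'_def)
      also have "\<dots> = ennreal (c' * m * mesh_size \<T> powr \<alpha>)"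
        using that by (subst ennreal_mult[symmetric]) (auto simp: c'_def ac_simps)
      finally show ?thesis .
    qed
    define C where "C = sqrt (2 * ((c' * M)\<^sup>2 + (c' * N)\<^sup>2 + (2 * C\<^sub>1 \<sigma>2)\<^sup>2))"
    have C: "0 < C"
      using \<open>0 < C\<^sub>1 \<sigma>2\<close> unfolding C_def by (simp add: add_nonneg_pos)
    have bound: "vdG_norm \<sigma>1 \<sigma>2 \<T> (\<Psi> - \<Psi>\<^sub>d\<^sub>G) \<le> ennreal (C * mesh_size \<T> powr \<alpha>)"
      if "\<T> \<in> \<F>" and "local_discrete_solution \<sigma>1 \<sigma>2 f \<T> (map_prod (\<I> \<T>) (\<I> \<T>) \<Psi>)
                      (2 * C\<^sub>1 \<sigma>2 * mesh_size \<T> powr \<alpha>) \<Psi>\<^sub>d\<^sub>G" for \<T> \<Psi>\<^sub>d\<^sub>G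
    proof -
      let ?t = "mesh_size \<T> powr \<alpha>"
      have "vdG_norm \<sigma>1 \<sigma>2 \<T> (\<Psi>\<^sub>d\<^sub>G - map_prod (\<I> \<T>) (\<I> \<T>) \<Psi>) \<le> ennreal (2 * C\<^sub>1 \<sigma>2 * ?t)"
        using that(2) by (simp add: local_discrete_solution_def dG_ball_def)
      then have "vdG_norm \<sigma>1 \<sigma>2 \<T> (\<Psi> - \<Psi>\<^sub>d\<^sub>G)
          \<le> ennreal (sqrt (2 * ((c' * M * ?t)\<^sup>2 + (c' * N * ?t)\<^sup>2 + (2 * C\<^sub>1 \<sigma>2 * ?t)\<^sup>2)))"
        using interp[OF that(1) \<Psi>(1) M] interp[OF that(1) \<Psi>(2) N] M(1) N(1) \<open>0 < C\<^sub>1 \<sigma>2\<close>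
        by (intro vdG_norm_diff_le) (simp_all add: c'_def)
      also have "2 * ((c' * M * ?t)\<^sup>2 + (c' * N * ?t)\<^sup>2 + (2 * C\<^sub>1 \<sigma>2 * ?t)\<^sup>2)
          = 2 * ((c' * M)\<^sup>2 + (c' * N)\<^sup>2 + (2 * C\<^sub>1 \<sigma>2)\<^sup>2) * ?t\<^sup>2"
        by (simp add: power_mult_distrib algebra_simps)
      also have "sqrt \<dots> = C * ?t"
        unfolding C_def by (simp add: real_sqrt_mult)
      finally show ?thesis .
    qed
    show ?thesis
      \<comment> \<open>The constants are uniform over all of \<open>\<F>\<close>, so the threshold \<open>1\<close> is an arbitrary choice.\<close>
      by (rule exI[of _ 1], rule conjI[OF zero_less_one], rule exI[of _ C], rule conjI[OF C])
        (intro ballI impI allI bound)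
  qed
  show ?thesis
    by (rule exI[of _ \<sigma>\<^sub>0], rule conjI[OF \<sigma>\<^sub>0(1)]) (intro allI impI estimate)
qed

end
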